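(* For every topological tree $S$, $$J(S)= \lim_{d \to \infty} I_d(S).$$
   Context: A topological tree is a finite rooted tree in which every non-leaf vertex has outdegree (number of children) at least $2$; the single-vertex tree is allowed, its vertex being both root and leaf. Trees are considered up to isomorphism of rooted trees (unordered, unlabelled). $|T|$ denotes the number of leaves of $T$. A nonempty set $L$ of leaves of $T$ induces a topological tree: take the smallest subtree of $T$ connecting the leaves in $L$, rooted at the most recent common ancestor of $L$, and suppress (erase, joining the neighbours) all vertices of outdegree $1$. For topological trees $S,T$, $c(S,T)$ is the number of subsets of the leaf set of $T$ whose induced tree is isomorphic, as a rooted tree, to $S$, and $\gamma(S,T)=c(S,T)/\binom{|T|}{|S|}$ (for $|T|\ge |S|$). The inducibility of $S$ (in topological trees) is $$J(S)=\limsup_{n\to\infty}\ \max_{\substack{|T|=n\\ T\text{ topological tree}}}\gamma(S,T).$$ For an integer $d\ge 2$, a $d$-ary tree is a topological tree in which every vertex has outdegree at most $d$. For a $d$-ary tree $D$, the inducibility of $D$ in $d$-ary trees is $$I_d(D)=\lim_{n\to\infty}\ \max_{\substack{|T|=n\\ T\ d\text{-ary tree}}}\gamma(D,T);$$ this limit is known to exist. Every topological tree $S$ is a $d$-ary tree for all sufficiently large $d$, so $I_d(S)$ is defined for all sufficiently large $d$. *)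

theory Defs
  imports Complex_Main "HOL-Library.Extended_Real"
begin

text \<open>Edges point from parent to child.\<close>

record 'a rtree =
  verts :: "'a set"
  tree_root :: 'a
  edges :: "('a \<times> 'a) set"

definition rooted_tree :: "'a rtree \<Rightarrow> bool" where
  "rooted_tree T \<longleftrightarrow>
     finite (verts T) \<and>
     tree_root T \<in> verts T \<and>
     edges T \<subseteq> verts T \<times> verts T \<and>
     (\<forall>u. (u, tree_root T) \<notin> edges T) \<and>
     (\<forall>v \<in> verts T - {tree_root T}. \<exists>!u. (u, v) \<in> edges T) \<and>
     (\<forall>v \<in> verts T. (tree_root T, v) \<in> (edges T)\<^sup>*)"

definition outdegree :: "'a rtree \<Rightarrow> 'a \<Rightarrow> nat" where
  "outdegree T v = card {w. (v, w) \<in> edges T}"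

definition leaves :: "'a rtree \<Rightarrow> 'a set" where
  "leaves T = {v \<in> verts T. outdegree T v = 0}"

definition num_leaves :: "'a rtree \<Rightarrow> nat" where
  "num_leaves T = card (leaves T)"

definition topological_tree :: "'a rtree \<Rightarrow> bool" where
  "topological_tree T \<longleftrightarrow>
     rooted_tree T \<and> (\<forall>v \<in> verts T - leaves T. outdegree T v \<ge> 2)"

definition dary_tree :: "nat \<Rightarrow> 'a rtree \<Rightarrow> bool" where
  "dary_tree d T \<longleftrightarrow> topological_tree T \<and> (\<forall>v \<in> verts T. outdegree T v \<le> d)"

definition rtree_iso :: "'a rtree \<Rightarrow> 'b rtree \<Rightarrow> bool" where
  "rtree_iso S T \<longleftrightarrow>
     (\<exists>f. bij_betw f (verts S) (verts T) \<and>
          f (tree_root S) = tree_root T \<and>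
          (\<forall>u \<in> verts S. \<forall>v \<in> verts S. (u, v) \<in> edges S \<longleftrightarrow> (f u, f v) \<in> edges T))"

definition ancestor :: "'a rtree \<Rightarrow> 'a \<Rightarrow> 'a \<Rightarrow> bool" where
  "ancestor T u v \<longleftrightarrow> (u, v) \<in> (edges T)\<^sup>*"

definition mrca :: "'a rtree \<Rightarrow> 'a set \<Rightarrow> 'a" where
  "mrca T L = (THE m. m \<in> verts T \<and> (\<forall>l \<in> L. ancestor T m l) \<and>
                 (\<forall>w \<in> verts T. (\<forall>l \<in> L. ancestor T w l) \<longrightarrow> ancestor T w m))"

definition connected_verts :: "'a rtree \<Rightarrow> 'a set \<Rightarrow> bool" where
  "connected_verts T U \<longleftrightarrow>
     U \<subseteq> verts T \<and>
     (\<forall>u \<in> U. \<forall>v \<in> U. (u, v) \<in> ((edges T \<union> (edges T)\<inverse>) \<inter> U \<times> U)\<^sup>*)"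

text \<open>Subtrees are given by connected vertex sets; in a tree these are closed under
  intersection, so the intersection below is the smallest subtree containing \<open>L\<close>.\<close>

definition spanning_verts :: "'a rtree \<Rightarrow> 'a set \<Rightarrow> 'a set" where
  "spanning_verts T L = \<Inter> {U. connected_verts T U \<and> L \<subseteq> U}"

definition spanning_subtree :: "'a rtree \<Rightarrow> 'a set \<Rightarrow> 'a rtree" where
  "spanning_subtree T L =
     \<lparr>verts = spanning_verts T L,
      tree_root = mrca T L,
      edges = edges T \<inter> spanning_verts T L \<times> spanning_verts T L\<rparr>"

text \<open>A new edge \<open>(u, v)\<close> stands for a downward path from \<open>u\<close> to \<open>v\<close> all of whose inner
  vertices are erased. The root is kept unchanged: in the spanning subtree of a
  nonempty set of leaves of a topological tree the most recent
  common ancestor never has outdegree 1.\<close>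

definition suppress :: "'a rtree \<Rightarrow> 'a rtree" where
  "suppress T =
     (let W = {v \<in> verts T. outdegree T v \<noteq> 1} in
      \<lparr>verts = W,
       tree_root = tree_root T,
       edges = (edges T O {(x, y) \<in> edges T. outdegree T x = 1}\<^sup>*) \<inter> W \<times> W\<rparr>)"

definition induced_tree :: "'a rtree \<Rightarrow> 'a set \<Rightarrow> 'a rtree" where
  "induced_tree T L = suppress (spanning_subtree T L)"

definition copies :: "'a rtree \<Rightarrow> 'b rtree \<Rightarrow> nat" where
  "copies S T = card {L. L \<noteq> {} \<and> L \<subseteq> leaves T \<and> rtree_iso (induced_tree T L) S}"

definition leaf_density :: "'a rtree \<Rightarrow> 'b rtree \<Rightarrow> real" where
  "leaf_density S T = real (copies S T) / real (num_leaves T choose num_leaves S)"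

text \<open>Every finite tree is isomorphic to one with vertices in \<open>nat\<close>, so the maxima may be
  taken over such trees. The set of values is finite for every \<open>n\<close> (there are at most
  \<open>2 ^ n\<close> leaf subsets), and for \<open>n \<ge> 1\<close> (and \<open>d \<ge> 2\<close>) it is nonempty.\<close>

definition max_density :: "'a rtree \<Rightarrow> nat \<Rightarrow> real" where
  "max_density S n =
     Max {leaf_density S T | T :: nat rtree. topological_tree T \<and> num_leaves T = n}"

definition max_density_dary :: "nat \<Rightarrow> 'a rtree \<Rightarrow> nat \<Rightarrow> real" where
  "max_density_dary d S n =
     Max {leaf_density S T | T :: nat rtree. dary_tree d T \<and> num_leaves T = n}"

definition inducibility :: "'a rtree \<Rightarrow> ereal" where
  "inducibility S = limsup (\<lambda>n. ereal (max_density S n))"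

definition inducibility_dary :: "nat \<Rightarrow> 'a rtree \<Rightarrow> real" where
  "inducibility_dary d S = lim (\<lambda>n. max_density_dary d S n)"

end

theory Submission
  imports Defs "HOL-Library.FuncSet" "HOL-Analysis.Extended_Real_Limits"
begin

text \<open>Replace the \<open>k\<close> leaves of a tree \<open>T\<close> by trees with about \<open>n / k\<close> leaves each. A set of
  leaves of the resulting tree that meets each of these trees at most once induces the same tree as
  its projection to \<open>T\<close>, so as \<open>n \<rightarrow> \<infinity>\<close> the density of \<open>S\<close> is at least
  \<open>\<gamma>(S,T)\<close> times the probability that \<open>|S|\<close> independent uniform elements of a \<open>k\<close>-set are
  distinct. If binary trees are substituted, then the blow-up of a \<open>d\<close>-ary tree is \<open>d\<close>-ary. Letting \<open>T\<close>
  range over optimal \<open>d\<close>-ary trees gives \<open>limsup \<le> liminf\<close>, hence the existence of \<open>I\<^sub>d(S)\<close>.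
  Letting \<open>T\<close> range over optimal topological trees, each of which is \<open>d\<close>-ary for some \<open>d\<close>, gives
  \<open>J(S) \<le> sup I\<^sub>d(S)\<close>; the converse inequality and the monotonicity of \<open>I\<^sub>d(S)\<close> in \<open>d\<close> are clear.
  The blow-up is built by repeatedly splitting one leaf into two.\<close>

section \<open>Rooted trees\<close>

lemma outdegree_eq_0I: "(\<And>w. (v, w) \<notin> edges T) \<Longrightarrow> outdegree T v = 0"
  by (simp add: outdegree_def)

lemma rooted_tree_parent_unique:
  assumes "rooted_tree T" "(x, z) \<in> edges T" "(y, z) \<in> edges T"
  shows "x = y"
  using assms unfolding rooted_tree_def by blast

lemma rooted_tree_finite_edges: "rooted_tree T \<Longrightarrow> finite (edges T)"
  unfolding rooted_tree_def by (meson finite_SigmaI finite_subset)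

lemma rooted_tree_finite_children: "rooted_tree T \<Longrightarrow> finite {w. (v, w) \<in> edges T}"
  by (rule finite_subset[of _ "snd ` edges T"]) (force simp: rooted_tree_finite_edges)+

lemma leaves_iff:
  assumes "rooted_tree T"
  shows "v \<in> leaves T \<longleftrightarrow> v \<in> verts T \<and> (\<forall>w. (v, w) \<notin> edges T)"
  using rooted_tree_finite_children[OF assms] by (auto simp: leaves_def outdegree_def)

text \<open>A cycle through \<open>z\<close> must enter \<open>z\<close> through its only parent, so
  it also passes through that parent. Induction along the path from the root pushes any cycle up to
  the root, which has no incoming edge.\<close>

lemma rooted_tree_acyclic:
  assumes "rooted_tree T"
  shows "acyclic (edges T)"
proof -
  have no_cycle: "(x, x) \<notin> (edges T)\<^sup>+" if "(tree_root T, x) \<in> (edges T)\<^sup>*" for x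
    using that
  proof (induction rule: rtrancl_induct)
    case base
    show ?case using assms unfolding rooted_tree_def by (meson tranclE)
  next
    case (step y z)
    show ?case
    proof
      assume "(z, z) \<in> (edges T)\<^sup>+"
      then obtain u where "(z, u) \<in> (edges T)\<^sup>*" "(u, z) \<in> edges T"
        by (meson tranclD2)
      then have "(y, y) \<in> (edges T)\<^sup>+"
        using rooted_tree_parent_unique[OF assms] step.hyps by (metis rtrancl_into_trancl2)
      then show False using step.IH by simp
    qed
  qed
  show ?thesis
  proof (rule acyclicI, intro allI notI)
    fix x assume x: "(x, x) \<in> (edges T)\<^sup>+"
    then have "x \<in> verts T"
      using assms unfolding rooted_tree_def by (meson SigmaD1 converse_tranclE subsetD)
    then show False using no_cycle x assms unfolding rooted_tree_def by blast
  qed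
qed

text \<open>Supports induction in which the claim is known for all children of a vertex, and the
  choice of a lowest vertex in a nonempty set.\<close>

lemma rooted_tree_wf: "rooted_tree T \<Longrightarrow> wf ((edges T)\<inverse>)"
  by (simp add: finite_acyclic_wf_converse rooted_tree_acyclic rooted_tree_finite_edges)

lemma ancestor_antisym:
  "rooted_tree T \<Longrightarrow> ancestor T x y \<Longrightarrow> ancestor T y x \<Longrightarrow> x = y"
  unfolding ancestor_def
  using acyclic_impl_antisym_rtrancl[OF rooted_tree_acyclic] by (blast dest: antisymD)

text \<open>Parents are unique, so the ancestors of a fixed vertex form a chain.\<close>

lemma ancestors_comparable:
  assumes "rooted_tree T" "ancestor T x z" "ancestor T y z"
  shows "ancestor T x y \<or> ancestor T y x"
  using assms(2,3) unfolding ancestor_def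
proof (induction arbitrary: y rule: rtrancl_induct)
  case base
  then show ?case by simp
next
  case (step u z)
  show ?case
  proof (cases "y = z")
    case True
    then show ?thesis using step.hyps by (meson rtrancl.rtrancl_into_rtrancl)
  next
    case False
    then obtain u' where "(y, u') \<in> (edges T)\<^sup>*" "(u', z) \<in> edges T"
      using step.prems by (meson rtranclE)
    then show ?thesis
      using rooted_tree_parent_unique[OF assms(1)] step by blast
  qed
qed

lemma ancestor_of_leaf:
  assumes "rooted_tree T" "l \<in> leaves T" "ancestor T l x"
  shows "x = l"
  using assms(3,2) unfolding ancestor_def
  by (cases rule: converse_rtranclE) (auto simp: leaves_iff[OF assms(1)])

text \<open>\<open>mrca\<close> is a definite description, so unique existence has to be shown
  first. A lowest common ancestor exists by well-foundedness; every other common ancestor is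
  comparable with it, hence lies above it.\<close>

lemma mrca_in_verts:
  assumes T: "rooted_tree T" and L: "L \<subseteq> verts T" "L \<noteq> {}"
  shows "mrca T L \<in> verts T"
proof -
  define A where "A = {w \<in> verts T. \<forall>l\<in>L. ancestor T w l}"
  have "tree_root T \<in> A"
    using T L unfolding A_def rooted_tree_def ancestor_def by blast
  moreover have "wf (((edges T)\<inverse>)\<^sup>+)" using rooted_tree_wf[OF T] by (rule wf_trancl)
  ultimately obtain m where m: "m \<in> A" "\<And>w. (w, m) \<in> ((edges T)\<inverse>)\<^sup>+ \<Longrightarrow> w \<notin> A"
    by (metis wfE_min)
  have "ancestor T w m" if w: "w \<in> A" for w
  proof -
    obtain l where "l \<in> L" using L by blast
    then have "ancestor T w m \<or> ancestor T m w"
      using ancestors_comparable[OF T] m(1) w unfolding A_def by blast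
    moreover have "(m, w) \<notin> (edges T)\<^sup>+" using m(2) w by (auto simp: trancl_converse)
    ultimately show ?thesis by (auto simp: ancestor_def dest: rtranclD)
  qed
  then have "\<exists>!m. m \<in> verts T \<and> (\<forall>l \<in> L. ancestor T m l) \<and>
                 (\<forall>w \<in> verts T. (\<forall>l \<in> L. ancestor T w l) \<longrightarrow> ancestor T w m)"
    using m(1) ancestor_antisym[OF T] unfolding A_def by (intro ex1I[of _ m]) auto
  from theI'[OF this] show ?thesis unfolding mrca_def by blast
qed

section \<open>Spanning subtrees and induced trees\<close>

text \<open>Vertices are joined inside \<open>{v. \<exists>l\<in>L. ancestor T v l}\<close> through the root.\<close>

lemma connected_verts_ancestors:
  assumes T: "rooted_tree T" and L: "L \<subseteq> verts T"
  shows "connected_verts T {v \<in> verts T. \<exists>l\<in>L. ancestor T v l}"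
proof -
  let ?A = "{v \<in> verts T. \<exists>l\<in>L. ancestor T v l}"
  let ?R = "(edges T \<union> (edges T)\<inverse>) \<inter> ?A \<times> ?A"
  have root: "(tree_root T, v) \<in> ?R\<^sup>*" if "v \<in> ?A" for v
  proof -
    have "(tree_root T, v) \<in> (edges T)\<^sup>*" using T that unfolding rooted_tree_def by blast
    then show ?thesis using that
    proof (induction rule: rtrancl_induct)
      case base
      then show ?case by simp
    next
      case (step y z)
      have "y \<in> ?A"
        using step.prems step.hyps(2) T unfolding rooted_tree_def ancestor_def
        by (auto intro: converse_rtrancl_into_rtrancl)
      then show ?case using step by (auto intro: rtrancl_into_rtrancl)
    qed
  qed
  have "sym ?R" by (auto simp: sym_def)
  then have "sym (?R\<^sup>*)" by (rule sym_rtrancl)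
  then have "(u, v) \<in> ?R\<^sup>*" if "u \<in> ?A" "v \<in> ?A" for u v
    using root[OF that(1)] root[OF that(2)] by (meson rtrancl_trans symD)
  then show ?thesis unfolding connected_verts_def by blast
qed

lemma connected_verts_verts:
  assumes "rooted_tree T"
  shows "connected_verts T (verts T)"
proof -
  have "{v \<in> verts T. \<exists>l\<in>verts T. ancestor T v l} = verts T"
    by (auto simp: ancestor_def)
  with connected_verts_ancestors[OF assms, of "verts T"] show ?thesis by simp
qed

lemma subset_spanning_verts: "L \<subseteq> spanning_verts T L"
  by (auto simp: spanning_verts_def)

lemma spanning_verts_subset:
  assumes "rooted_tree T" "L \<subseteq> verts T"
  shows "spanning_verts T L \<subseteq> verts T"
  using connected_verts_verts[OF assms(1)] assms(2) unfolding spanning_verts_def by blast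

text \<open>The ancestors of \<open>L\<close> form a connected set containing \<open>L\<close>, so
  the smallest such set lies inside it.\<close>

lemma spanning_verts_ancestor:
  assumes "rooted_tree T" "L \<subseteq> verts T" "v \<in> spanning_verts T L"
  obtains l where "l \<in> L" "ancestor T v l"
proof -
  have "L \<subseteq> {v \<in> verts T. \<exists>l\<in>L. ancestor T v l}"
    using assms(2) by (auto simp: ancestor_def)
  with connected_verts_ancestors[OF assms(1,2)] assms(3)
  show ?thesis using that unfolding spanning_verts_def by blast
qed

text \<open>The only way out of the set of descendants of \<open>c\<close> is through
  \<open>c\<close>. If \<open>c\<close> were missing from \<open>U\<close>, a walk inside
  \<open>U\<close> from \<open>l\<close> to \<open>v\<close> would stay below \<open>c\<close>, and
  the edge from \<open>v\<close> to \<open>c\<close> would close a cycle.\<close>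

lemma connected_verts_path_closed:
  assumes T: "rooted_tree T" and U: "connected_verts T U" "v \<in> U" "l \<in> U"
    and c: "(v, c) \<in> edges T" "ancestor T c l"
  shows "c \<in> U"
proof (rule ccontr)
  assume "c \<notin> U"
  have "(l, v) \<in> ((edges T \<union> (edges T)\<inverse>) \<inter> U \<times> U)\<^sup>*"
    using U unfolding connected_verts_def by blast
  then have "ancestor T c v"
  proof (induction rule: rtrancl_induct)
    case base
    show ?case by (rule c(2))
  next
    case (step y z)
    show ?case
    proof (cases "(y, z) \<in> edges T")
      case True
      then show ?thesis using step.IH unfolding ancestor_def by (rule rtrancl_into_rtrancl[rotated])
    next
      case False
      then have zy: "(z, y) \<in> edges T" "y \<in> U" using step.hyps by auto
      then have "c \<noteq> y" using \<open>c \<notin> U\<close> by blast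
      then obtain u where "ancestor T c u" "(u, y) \<in> edges T"
        using step.IH unfolding ancestor_def by (meson rtranclE)
      then show ?thesis using rooted_tree_parent_unique[OF T zy(1)] by blast
    qed
  qed
  then have "(v, v) \<in> (edges T)\<^sup>+"
    using c(1) unfolding ancestor_def by (meson rtrancl_into_trancl2)
  then show False using rooted_tree_acyclic[OF T] by (auto simp: acyclic_def)
qed

text \<open>Ensures that the spanning subtree has no leaf outside \<open>L\<close>: the first vertex
  on the way from \<open>v\<close> down to an element of \<open>L\<close> lies in every connected
  set considered.\<close>

lemma spanning_verts_child:
  assumes T: "rooted_tree T" and L: "L \<subseteq> verts T"
    and v: "v \<in> spanning_verts T L" "v \<notin> L"
  obtains c where "(v, c) \<in> edges T" "c \<in> spanning_verts T L"
proof -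
  obtain l where l: "l \<in> L" "ancestor T v l"
    using spanning_verts_ancestor[OF T L v(1)] .
  then obtain c where c: "(v, c) \<in> edges T" "ancestor T c l"
    using v(2) unfolding ancestor_def by (metis converse_rtranclE)
  have "c \<in> spanning_verts T L"
    unfolding spanning_verts_def
    using connected_verts_path_closed[OF T _ _ _ c] l(1) v(1)
    by (auto simp: spanning_verts_def)
  with c(1) show ?thesis using that by blast
qed

text \<open>Elements of \<open>L\<close> have outdegree 0 in the spanning subtree and survive
  suppression as leaves. Any other surviving vertex keeps a child, found by descending through
  erased vertices.\<close>

lemma leaves_induced_tree:
  assumes T: "rooted_tree T" and L: "L \<subseteq> leaves T"
  shows "leaves (induced_tree T L) = L"
proof -
  define P where "P = spanning_subtree T L"
  have LV: "L \<subseteq> verts T" using L by (auto simp: leaves_def)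
  have EP: "edges P = edges T \<inter> verts P \<times> verts P" and VP: "verts P = spanning_verts T L"
    by (auto simp: P_def spanning_subtree_def)
  have VT: "verts P \<subseteq> verts T" using spanning_verts_subset[OF T LV] VP by simp
  then have fin: "finite (verts P)" using T finite_subset unfolding rooted_tree_def by blast
  define W where "W = {v \<in> verts P. outdegree P v \<noteq> 1}"
  define D where "D = {(x, y) \<in> edges P. outdegree P x = 1}"
  have I: "verts (induced_tree T L) = W" "edges (induced_tree T L) = (edges P O D\<^sup>*) \<inter> W \<times> W"
    by (simp_all add: induced_tree_def suppress_def Let_def W_def D_def P_def)
  \<comment> \<open>A downward chain of vertices of outdegree 1 cannot go on forever, so it ends in
    a vertex that is kept.\<close>
  have descend: "\<exists>w\<in>W. (c, w) \<in> D\<^sup>*" if "c \<in> verts P" for c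
    using rooted_tree_wf[OF T] that
  proof (induction c rule: wf_induct_rule)
    case (less c)
    show ?case
    proof (cases "c \<in> W")
      case True
      then show ?thesis by blast
    next
      case False
      then have 1: "outdegree P c = 1" using less.prems by (auto simp: W_def)
      then obtain e where e: "(c, e) \<in> edges P"
        unfolding outdegree_def by (metis card_1_singletonE insertI1 mem_Collect_eq)
      then obtain w where "w \<in> W" "(e, w) \<in> D\<^sup>*" using less.IH[of e] EP by auto
      moreover have "(c, e) \<in> D" using e 1 by (simp add: D_def)
      ultimately show ?thesis by (meson converse_rtrancl_into_rtrancl)
    qed
  qed
  have inner: "outdegree (induced_tree T L) v \<noteq> 0" if v: "v \<in> W" "v \<notin> L" for v
  proof -
    have "v \<in> spanning_verts T L" using v VP by (auto simp: W_def)
    then obtain c where "(v, c) \<in> edges T" "c \<in> spanning_verts T L"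
      using spanning_verts_child[OF T LV _ v(2)] by blast
    then have c: "(v, c) \<in> edges P" "c \<in> verts P" using EP VP v by (auto simp: W_def)
    then obtain w where "w \<in> W" "(c, w) \<in> D\<^sup>*" using descend by blast
    then have "(v, w) \<in> edges (induced_tree T L)" using c v I by blast
    moreover have "finite {w. (v, w) \<in> edges (induced_tree T L)}"
      by (rule finite_subset[OF _ fin]) (auto simp: I W_def)
    ultimately show ?thesis by (auto simp: outdegree_def)
  qed
  have outer: "l \<in> W \<and> outdegree (induced_tree T L) l = 0" if l: "l \<in> L" for l
  proof -
    have "\<And>w. (l, w) \<notin> edges P" using l L leaves_iff[OF T] EP by blast
    moreover have "l \<in> verts P" using l VP subset_spanning_verts by fastforce
    ultimately show ?thesis by (auto simp: W_def I intro!: outdegree_eq_0I) (simp add: outdegree_eq_0I)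
  qed
  show ?thesis unfolding leaves_def I using inner outer by blast
qed

text \<open>The one-leaf case is computed by hand because the spanning subtree of a single new leaf
  does not contain its parent, which the general comparison in \<open>induced_tree_split\<close>
  relies on.\<close>

lemma induced_tree_singleton:
  assumes T: "rooted_tree T" and l: "l \<in> leaves T"
  shows "induced_tree T {l} = \<lparr>verts = {l}, tree_root = l, edges = {}\<rparr>"
proof -
  have lV: "l \<in> verts T" using l by (simp add: leaves_def)
  then have "connected_verts T {l}" by (auto simp: connected_verts_def)
  then have V: "spanning_verts T {l} = {l}" by (auto simp: spanning_verts_def)
  have M: "mrca T {l} = l"
    unfolding mrca_def
    using lV ancestor_of_leaf[OF T l] by (intro the_equality) (auto simp: ancestor_def)
  have "(l, l) \<notin> edges T" using leaves_iff[OF T] l by blast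
  then have "spanning_subtree T {l} = \<lparr>verts = {l}, tree_root = l, edges = {}\<rparr>"
    using V M by (auto simp: spanning_subtree_def)
  then show ?thesis by (auto simp: induced_tree_def suppress_def outdegree_def)
qed

section \<open>Isomorphisms and leaf counts\<close>

lemma rtree_iso_refl: "rtree_iso T T"
  unfolding rtree_iso_def by (rule exI[of _ id]) auto

lemma rtree_iso_trans:
  assumes "rtree_iso R S" "rtree_iso S T"
  shows "rtree_iso R T"
proof -
  obtain f g where f: "bij_betw f (verts R) (verts S)" "f (tree_root R) = tree_root S"
      "\<forall>u \<in> verts R. \<forall>v \<in> verts R. (u, v) \<in> edges R \<longleftrightarrow> (f u, f v) \<in> edges S"
    and g: "bij_betw g (verts S) (verts T)" "g (tree_root S) = tree_root T"
      "\<forall>u \<in> verts S. \<forall>v \<in> verts S. (u, v) \<in> edges S \<longleftrightarrow> (g u, g v) \<in> edges T"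
    using assms unfolding rtree_iso_def by blast
  have "\<forall>u\<in>verts R. f u \<in> verts S" using f(1) by (auto simp: bij_betw_def)
  then show ?thesis unfolding rtree_iso_def
    using f g bij_betw_trans[OF f(1) g(1)] by (intro exI[of _ "g \<circ> f"]) auto
qed

text \<open>An isomorphism preserves outdegrees. The edges must stay within the vertex sets since
  \<open>rtree_iso\<close> compares edges only there, while \<open>outdegree\<close> counts all
  edges.\<close>

lemma rtree_iso_num_leaves:
  assumes "rtree_iso S T" "edges S \<subseteq> verts S \<times> verts S" "edges T \<subseteq> verts T \<times> verts T"
  shows "num_leaves S = num_leaves T"
proof -
  obtain f where f: "bij_betw f (verts S) (verts T)"
      "\<And>u v. u \<in> verts S \<Longrightarrow> v \<in> verts S \<Longrightarrow> (u, v) \<in> edges S \<longleftrightarrow> (f u, f v) \<in> edges T"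
    using assms(1) unfolding rtree_iso_def by blast
  have inj: "inj_on f (verts S)" and im: "f ` verts S = verts T" using f(1) by (auto simp: bij_betw_def)
  have out: "outdegree T (f u) = outdegree S u" if u: "u \<in> verts S" for u
  proof -
    have "{w. (f u, w) \<in> edges T} = f ` {w. (u, w) \<in> edges S}"
    proof
      show "{w. (f u, w) \<in> edges T} \<subseteq> f ` {w. (u, w) \<in> edges S}"
      proof
        fix w assume w: "w \<in> {w. (f u, w) \<in> edges T}"
        then have "w \<in> f ` verts S" using assms(3) im by auto
        then show "w \<in> f ` {w. (u, w) \<in> edges S}" using f(2)[OF u] w by auto
      qed
      show "f ` {w. (u, w) \<in> edges S} \<subseteq> {w. (f u, w) \<in> edges T}"
        using assms(2) f(2)[OF u] by auto
    qed
    moreover have "inj_on f {w. (u, w) \<in> edges S}"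
      using inj by (rule inj_on_subset) (use assms(2) in auto)
    ultimately show ?thesis by (simp add: outdegree_def card_image)
  qed
  have "leaves T = f ` leaves S" using out by (auto simp: leaves_def simp flip: im)
  moreover have "inj_on f (leaves S)" using inj by (rule inj_on_subset) (auto simp: leaves_def)
  ultimately show ?thesis by (simp add: num_leaves_def card_image)
qed

lemma rtree_iso_induced_card:
  assumes "rooted_tree T" "L \<subseteq> leaves T" "rooted_tree S" "rtree_iso (induced_tree T L) S"
  shows "card L = num_leaves S"
proof -
  have "num_leaves (induced_tree T L) = num_leaves S"
    using assms(3) by (intro rtree_iso_num_leaves[OF assms(4)])
      (auto simp: rooted_tree_def induced_tree_def suppress_def Let_def)
  then show ?thesis using leaves_induced_tree[OF assms(1,2)] by (simp add: num_leaves_def)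
qed

section \<open>Splitting a leaf into two\<close>

text \<open>The old leaf \<open>v\<close> stays as the parent of a cherry with leaves
  \<open>a\<close> and \<open>b\<close>. Growing trees in binary steps keeps them
  \<open>d\<close>-ary for every \<open>d \<ge> 2\<close>.\<close>

definition split_leaf :: "'a rtree \<Rightarrow> 'a \<Rightarrow> 'a \<Rightarrow> 'a \<Rightarrow> 'a rtree" where
  "split_leaf T v a b =
     \<lparr>verts = insert a (insert b (verts T)), tree_root = tree_root T,
      edges = insert (v, a) (insert (v, b) (edges T))\<rparr>"

lemma split_leaf_commute: "split_leaf T v a b = split_leaf T v b a"
  by (auto simp: split_leaf_def)

text \<open>Hanging one new leaf \<open>a\<close> below the leaf \<open>v\<close> gives
  \<open>v\<close> outdegree 1, so suppression erases \<open>v\<close> and \<open>a\<close> takes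
  its place.\<close>

lemma suppress_extend_leaf:
  assumes E: "edges P \<subseteq> verts P \<times> verts P" and v: "v \<in> verts P" "\<And>w. (v, w) \<notin> edges P"
    and a: "a \<notin> verts P" and root: "tree_root P \<noteq> a"
  shows "rtree_iso
    (suppress \<lparr>verts = insert a (verts P), tree_root = tree_root P,
               edges = insert (v, a) (edges P)\<rparr>) (suppress P)"
proof -
  let ?P = "\<lparr>verts = insert a (verts P), tree_root = tree_root P, edges = insert (v, a) (edges P)\<rparr>"
  define f where "f x = (if x = a then v else x)" for x
  have va: "v \<noteq> a" using v a by blast
  have out: "outdegree ?P x = (if x = v then 1 else outdegree P x)" for x
    using v(2) by (auto simp: outdegree_def)
  have outa: "outdegree P a = 0" using E a by (intro outdegree_eq_0I) auto
  have outv: "outdegree P v = 0" using v(2) by (simp add: outdegree_def)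
  define W where "W = {x \<in> verts P. outdegree P x \<noteq> 1}"
  define D where "D = {(x, y) \<in> edges P. outdegree P x = 1}"
  define D' where "D' = {(x, y) \<in> edges ?P. outdegree ?P x = 1}"
  have W': "{x \<in> verts ?P. outdegree ?P x \<noteq> 1} = insert a (W - {v})"
    using out outa va by (auto simp: W_def)
  have D': "D' = insert (v, a) D" using out v by (auto simp: D'_def D_def split: if_splits)
  \<comment> \<open>\<open>f\<close> contracts the extra edge from \<open>v\<close> to
    \<open>a\<close> and fixes the endpoints of all edges in \<open>D\<close>.\<close>
  have fD: "(f x, f y) \<in> D\<^sup>*" if "(x, y) \<in> D'\<^sup>*" for x y
    using that
  proof (induction rule: rtrancl_induct)
    case base
    show ?case by simp
  next
    case (step y z)
    show ?case
    proof (cases "(y, z) = (v, a)")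
      case True
      then show ?thesis using step.IH va by (simp add: f_def)
    next
      case False
      then have "(y, z) \<in> D" using step.hyps D' by auto
      moreover have "f y = y" "f z = z" using \<open>(y, z) \<in> D\<close> E a by (auto simp: f_def D_def)
      ultimately show ?thesis using step.IH by (metis rtrancl.rtrancl_into_rtrancl)
    qed
  qed
  have DD': "D\<^sup>* \<subseteq> D'\<^sup>*" unfolding D' by (rule rtrancl_mono) blast
  have edge: "(x, y) \<in> edges ?P O D'\<^sup>* \<longleftrightarrow> (f x, f y) \<in> edges P O D\<^sup>*"
    if x: "x \<in> insert a (W - {v})" and y: "y \<in> insert a (W - {v})" for x y
  proof
    assume "(x, y) \<in> edges ?P O D'\<^sup>*"
    then obtain c where c: "(x, c) \<in> edges ?P" "(c, y) \<in> D'\<^sup>*" by blast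
    then have "(x, c) \<in> edges P" using x va by auto
    moreover from this have "f x = x" "f c = c" using E a by (auto simp: f_def)
    ultimately show "(f x, f y) \<in> edges P O D\<^sup>*" using fD[OF c(2)] by auto
  next
    assume "(f x, f y) \<in> edges P O D\<^sup>*"
    then obtain c where c: "(f x, c) \<in> edges P" "(c, f y) \<in> D\<^sup>*" by blast
    then have "f x = x" using v(2) by (auto simp: f_def split: if_splits)
    then have 1: "(x, c) \<in> edges ?P" using c by simp
    have 2: "(c, f y) \<in> D'\<^sup>*" using c DD' by blast
    \<comment> \<open>For \<open>y = a\<close> this is the new edge, which prolongs the path beyond
      the erased vertex \<open>v\<close>.\<close>
    have "(f y, y) \<in> D'\<^sup>*" using D' by (auto simp: f_def)
    with 2 have "(c, y) \<in> D'\<^sup>*" by (rule rtrancl_trans)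
    with 1 show "(x, y) \<in> edges ?P O D'\<^sup>*" by blast
  qed
  have bij: "bij_betw f (insert a (W - {v})) W"
    unfolding bij_betw_def
  proof
    show "inj_on f (insert a (W - {v}))"
      using a by (auto simp: inj_on_def f_def)
    have "v \<in> W" "a \<notin> W" using v outv a by (auto simp: W_def)
    then show "f ` insert a (W - {v}) = W" by (auto simp: f_def)
  qed
  have fW: "f x \<in> W" if "x \<in> insert a (W - {v})" for x
    using bij that by (auto simp: bij_betw_def)
  have S: "suppress P = \<lparr>verts = W, tree_root = tree_root P, edges = (edges P O D\<^sup>*) \<inter> W \<times> W\<rparr>"
    by (simp add: suppress_def Let_def W_def D_def)
  have S': "suppress ?P = \<lparr>verts = insert a (W - {v}), tree_root = tree_root P,
      edges = (edges ?P O D'\<^sup>*) \<inter> insert a (W - {v}) \<times> insert a (W - {v})\<rparr>"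
    unfolding suppress_def Let_def W' D'_def by simp
  have "f (tree_root P) = tree_root P" using root a by (auto simp: f_def)
  with bij edge fW show ?thesis
    unfolding S S' rtree_iso_def by (intro exI[of _ f]) auto
qed

locale leaf_split =
  fixes T :: "'a rtree" and v a b :: 'a
  assumes tree: "rooted_tree T" and leaf: "v \<in> leaves T"
    and fresh: "a \<notin> verts T" "b \<notin> verts T" "a \<noteq> b"
begin

abbreviation T' :: "'a rtree" where "T' \<equiv> split_leaf T v a b"

text \<open>Contracts the cherry back to \<open>v\<close>; walks, ancestors and leaf sets of
  \<open>T'\<close> are compared with those of \<open>T\<close> through this map.\<close>

definition retract :: "'a \<Rightarrow> 'a" where "retract x = (if x = a \<or> x = b then v else x)"

lemma swap: "leaf_split T v b a"
  using tree leaf fresh by (simp add: leaf_split_def)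

lemma v_verts: "v \<in> verts T" and v_childless: "(v, w) \<notin> edges T"
  using leaf leaves_iff[OF tree] by blast+

lemma edges_subset: "edges T \<subseteq> verts T \<times> verts T"
  using tree by (simp add: rooted_tree_def)

lemma verts': "verts T' = insert a (insert b (verts T))"
  and root': "tree_root T' = tree_root T"
  and edges': "edges T' = insert (v, a) (insert (v, b) (edges T))"
  by (simp_all add: split_leaf_def)

lemma retract_verts: "x \<in> verts T \<Longrightarrow> retract x = x"
  using fresh by (auto simp: retract_def)

lemma retract_step: "(x, y) \<in> edges T' \<Longrightarrow> (retract x, retract y) \<in> (edges T)\<^sup>="
  using edges_subset fresh v_verts by (auto simp: edges' retract_def)

lemma retract_rtrancl: "(x, y) \<in> (edges T')\<^sup>* \<Longrightarrow> (retract x, retract y) \<in> (edges T)\<^sup>*"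
proof (induction rule: rtrancl_induct)
  case base
  show ?case by simp
next
  case (step y z)
  then show ?case using retract_step[OF step.hyps(2)] by (auto intro: rtrancl_into_rtrancl)
qed

lemma outdegree':
  "outdegree T' x = (if x = v then 2 else outdegree T x)"
proof (cases "x = v")
  case True
  then have "{w. (x, w) \<in> edges T'} = {a, b}" using v_childless by (auto simp: edges')
  with True show ?thesis using fresh by (simp add: outdegree_def)
qed (simp add: outdegree_def edges')

lemma outdegree_fresh: "outdegree T a = 0" "outdegree T b = 0"
  using edges_subset fresh by (auto intro!: outdegree_eq_0I)

lemma leaves': "leaves T' = insert a (insert b (leaves T - {v}))"
  using outdegree_fresh fresh v_verts by (auto simp: leaves_def outdegree' verts')

lemma rooted_tree': "rooted_tree T'"
proof -
  have fin: "finite (verts T)" and r: "tree_root T \<in> verts T"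
    and nr: "\<And>u. (u, tree_root T) \<notin> edges T"
    and par: "\<And>w. w \<in> verts T - {tree_root T} \<Longrightarrow> \<exists>!u. (u, w) \<in> edges T"
    and reach: "\<And>w. w \<in> verts T \<Longrightarrow> (tree_root T, w) \<in> (edges T)\<^sup>*"
    using tree unfolding rooted_tree_def by blast+
  have mono: "(edges T)\<^sup>* \<subseteq> (edges T')\<^sup>*" by (rule rtrancl_mono) (auto simp: edges')
  have reach': "(tree_root T, w) \<in> (edges T')\<^sup>*" if w: "w \<in> verts T'" for w
  proof (cases "w \<in> verts T")
    case True
    then show ?thesis using reach mono by blast
  next
    case False
    then have "(v, w) \<in> edges T'" using w by (auto simp: verts' edges')
    moreover have "(tree_root T, v) \<in> (edges T')\<^sup>*" using reach[OF v_verts] mono by blast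
    ultimately show ?thesis by (rule rtrancl_into_rtrancl[rotated])
  qed
  have par': "\<exists>!u. (u, w) \<in> edges T'" if w: "w \<in> verts T' - {tree_root T'}" for w
  proof (cases "w \<in> verts T")
    case True
    then have "\<And>u. (u, w) \<in> edges T' \<longleftrightarrow> (u, w) \<in> edges T" using fresh by (auto simp: edges')
    then show ?thesis using par w True by (simp add: root')
  next
    case False
    then have "\<And>u. (u, w) \<in> edges T' \<longleftrightarrow> u = v"
      using w edges_subset by (auto simp: edges' verts')
    then show ?thesis by simp
  qed
  have nr': "(u, tree_root T) \<notin> edges T'" for u
    using nr r fresh by (auto simp: edges')
  show ?thesis unfolding rooted_tree_def
  proof (intro conjI ballI allI)
    show "finite (verts T')" "tree_root T' \<in> verts T'" using fin r by (simp_all add: verts' root')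
    show "edges T' \<subseteq> verts T' \<times> verts T'" using edges_subset v_verts by (auto simp: edges' verts')
  next
    show "(u, tree_root T') \<notin> edges T'" for u using nr' root' by simp
    show "\<exists>!u. (u, w) \<in> edges T'" if "w \<in> verts T' - {tree_root T'}" for w
      using par' that .
    show "(tree_root T', w) \<in> (edges T')\<^sup>*" if "w \<in> verts T'" for w
      using reach'[OF that] root' by simp
  qed
qed

text \<open>Among the old vertices only \<open>v\<close> changes its outdegree, from 0 to 2, which
  is where \<open>d \<ge> 2\<close> enters.\<close>

lemma dary_tree':
  assumes "dary_tree d T" "d \<ge> 2"
  shows "dary_tree d T'"
  unfolding dary_tree_def topological_tree_def
proof (intro conjI ballI)
  show "outdegree T' x \<ge> 2" if "x \<in> verts T' - leaves T'" for x
  proof (cases "x = v")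
    case False
    then have "x \<in> verts T - leaves T" using that by (auto simp: leaves' verts')
    then show ?thesis
      using assms(1) False by (simp add: dary_tree_def topological_tree_def outdegree')
  qed (simp add: outdegree')
  show "outdegree T' x \<le> d" if "x \<in> verts T'" for x
    using that assms outdegree_fresh by (auto simp: dary_tree_def outdegree' verts')
qed (rule rooted_tree')

section \<open>Ancestors after a split\<close>

lemma ancestor_retract:
  assumes x: "x \<in> verts T" and y: "y \<in> verts T'"
  shows "ancestor T' x y \<longleftrightarrow> ancestor T x (retract y)"
proof
  assume "ancestor T' x y"
  then show "ancestor T x (retract y)"
    using retract_rtrancl[of x y] retract_verts[OF x] by (simp add: ancestor_def)
next
  have "(edges T)\<^sup>* \<subseteq> (edges T')\<^sup>*" by (rule rtrancl_mono) (auto simp: edges')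
  moreover assume "ancestor T x (retract y)"
  ultimately have "(x, retract y) \<in> (edges T')\<^sup>*" by (auto simp: ancestor_def)
  moreover have "(retract y, y) \<in> (edges T')\<^sup>*" by (auto simp: edges' retract_def)
  ultimately show "ancestor T' x y" unfolding ancestor_def by (rule rtrancl_trans)
qed

lemma ancestor_fresh: "x \<in> {a, b} \<Longrightarrow> ancestor T' x y \<Longrightarrow> y = x"
  by (rule ancestor_of_leaf[OF rooted_tree']) (auto simp: leaves')

text \<open>New vertices are leaves, so an old vertex in \<open>L\<close> forces all common
  ancestors of \<open>L\<close> to be old. These are exactly the common ancestors of the contracted
  set, and the two definite descriptions agree.\<close>

lemma mrca_retract:
  assumes L: "L \<subseteq> verts T'" "L \<inter> verts T \<noteq> {}"
  shows "mrca T' L = mrca T (retract ` L)"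
proof -
  have common: "(w \<in> verts T' \<and> (\<forall>l\<in>L. ancestor T' w l)) \<longleftrightarrow>
      (w \<in> verts T \<and> (\<forall>l\<in>retract ` L. ancestor T w l))" for w
  proof (cases "w \<in> verts T")
    case True
    then have "\<forall>l\<in>L. ancestor T' w l \<longleftrightarrow> ancestor T w (retract l)"
      using ancestor_retract L(1) by blast
    then show ?thesis using True by (simp add: verts')
  next
    case False
    obtain l where l: "l \<in> L" "l \<in> verts T" using L(2) by blast
    have "\<not> ancestor T' w l" if "w \<in> verts T'"
      using that False l ancestor_fresh[of w l] by (auto simp: verts')
    then show ?thesis using False l by blast
  qed
  have "(m \<in> verts T' \<and> (\<forall>l \<in> L. ancestor T' m l) \<and>
         (\<forall>w \<in> verts T'. (\<forall>l \<in> L. ancestor T' w l) \<longrightarrow> ancestor T' w m)) \<longleftrightarrow>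
        (m \<in> verts T \<and> (\<forall>l \<in> retract ` L. ancestor T m l) \<and>
         (\<forall>w \<in> verts T. (\<forall>l \<in> retract ` L. ancestor T w l) \<longrightarrow> ancestor T w m))" for m
  proof (cases "m \<in> verts T \<and> (\<forall>l\<in>retract ` L. ancestor T m l)")
    case True
    then have "ancestor T' w m \<longleftrightarrow> ancestor T w m" if "w \<in> verts T" for w
      using ancestor_retract[OF that, of m] retract_verts[of m] by (simp add: verts')
    then have "(\<forall>w \<in> verts T'. (\<forall>l \<in> L. ancestor T' w l) \<longrightarrow> ancestor T' w m) \<longleftrightarrow>
      (\<forall>w \<in> verts T. (\<forall>l \<in> retract ` L. ancestor T w l) \<longrightarrow> ancestor T w m)"
      using common by blast
    then show ?thesis using common[of m] by blast
  next
    case False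
    then show ?thesis using common[of m] by blast
  qed
  then show ?thesis unfolding mrca_def by simp
qed

section \<open>Connected sets and induced trees after a split\<close>

lemma connected_verts_up:
  assumes "connected_verts T U"
  shows "connected_verts T' U"
proof -
  have "((edges T \<union> (edges T)\<inverse>) \<inter> U \<times> U)\<^sup>* \<subseteq> ((edges T' \<union> (edges T')\<inverse>) \<inter> U \<times> U)\<^sup>*"
    by (rule rtrancl_mono) (auto simp: edges')
  then show ?thesis using assms unfolding connected_verts_def by (auto simp: verts')
qed

lemma connected_verts_insert:
  assumes "connected_verts T U" "v \<in> U"
  shows "connected_verts T' (insert a U)"
proof -
  let ?R = "(edges T' \<union> (edges T')\<inverse>) \<inter> insert a U \<times> insert a U"
  have "((edges T' \<union> (edges T')\<inverse>) \<inter> U \<times> U)\<^sup>* \<subseteq> ?R\<^sup>*"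
    by (rule rtrancl_mono) auto
  then have U: "(x, y) \<in> ?R\<^sup>*" if "x \<in> U" "y \<in> U" for x y
    using connected_verts_up[OF assms(1)] that unfolding connected_verts_def by blast
  have "(v, a) \<in> ?R" "(a, v) \<in> ?R" using assms(2) by (auto simp: edges')
  then have "(v, x) \<in> ?R\<^sup>*" "(x, v) \<in> ?R\<^sup>*" if "x \<in> insert a U" for x
    using that U assms(2) by blast+
  then have "(x, y) \<in> ?R\<^sup>*" if "x \<in> insert a U" "y \<in> insert a U" for x y
    using that by (blast intro: rtrancl_trans)
  moreover have "insert a U \<subseteq> verts T'"
    using assms(1) by (auto simp: connected_verts_def verts')
  ultimately show ?thesis by (auto simp: connected_verts_def)
qed

text \<open>Contraction turns a walk inside \<open>U\<close> into a walk with pauses inside the old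
  part of \<open>U\<close>: an edge at \<open>a\<close> or \<open>b\<close> has \<open>v\<close> as
  its other end and collapses to \<open>v\<close>.\<close>

lemma connected_verts_down:
  assumes "connected_verts T' U"
  shows "connected_verts T (U \<inter> verts T)"
proof -
  let ?R = "(edges T' \<union> (edges T')\<inverse>) \<inter> U \<times> U"
  let ?Q = "(edges T \<union> (edges T)\<inverse>) \<inter> (U \<inter> verts T) \<times> (U \<inter> verts T)"
  have edge: "(retract x, retract y) \<in> ?Q\<^sup>=" if "(x, y) \<in> ?R" for x y
    using that edges_subset fresh v_verts by (auto simp: edges' retract_def)
  have "(retract x, retract y) \<in> (?Q\<^sup>=)\<^sup>*" if "(x, y) \<in> ?R\<^sup>*" for x y
    using that
  proof (induction rule: rtrancl_induct)
    case base
    show ?case by (rule rtrancl.rtrancl_refl)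
  next
    case (step y z)
    show ?case by (rule rtrancl_into_rtrancl[OF step.IH edge[OF step.hyps(2)]])
  qed
  then have path: "(retract x, retract y) \<in> ?Q\<^sup>*" if "(x, y) \<in> ?R\<^sup>*" for x y
    using that by (simp only: rtrancl_reflcl)
  have "(x, y) \<in> ?Q\<^sup>*" if "x \<in> U \<inter> verts T" "y \<in> U \<inter> verts T" for x y
  proof -
    have "(x, y) \<in> ?R\<^sup>*" using assms that unfolding connected_verts_def by blast
    then show ?thesis using path[of x y] that retract_verts by simp
  qed
  then show ?thesis unfolding connected_verts_def by blast
qed

text \<open>The only neighbour of \<open>a\<close> is \<open>v\<close>.\<close>

lemma connected_verts_parent:
  assumes "connected_verts T' U" "a \<in> U" "x \<in> U" "x \<noteq> a"
  shows "v \<in> U"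
proof -
  have "(a, x) \<in> ((edges T' \<union> (edges T')\<inverse>) \<inter> U \<times> U)\<^sup>*"
    using assms unfolding connected_verts_def by blast
  then obtain z where "(a, z) \<in> (edges T' \<union> (edges T')\<inverse>) \<inter> U \<times> U"
    using assms(4) by (metis converse_rtranclE)
  then show ?thesis using edges_subset fresh v_verts by (auto simp: edges')
qed

text \<open>The smallest connected set containing old leaves does not reach \<open>a\<close> or
  \<open>b\<close>, so the split is invisible to \<open>L\<close>.\<close>

lemma induced_tree_unsplit:
  assumes L: "L \<subseteq> leaves T'" "L \<noteq> {}" "a \<notin> L" "b \<notin> L"
  shows "induced_tree T' L = induced_tree T L"
proof -
  have "L \<subseteq> leaves T" using L by (auto simp: leaves')
  then have LV: "L \<subseteq> verts T" by (auto simp: leaves_def)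
  have "retract ` L = id ` L" using LV retract_verts by (intro image_cong) auto
  then have M: "mrca T' L = mrca T L"
    using mrca_retract[of L] LV L(2) by (simp add: verts' Int_absorb2 subset_insertI2)
  have V: "spanning_verts T' L = spanning_verts T L"
  proof
    show "spanning_verts T' L \<subseteq> spanning_verts T L"
      unfolding spanning_verts_def using connected_verts_up by blast
    show "spanning_verts T L \<subseteq> spanning_verts T' L"
      unfolding spanning_verts_def using connected_verts_down LV by blast
  qed
  have "spanning_verts T L \<subseteq> verts T" by (rule spanning_verts_subset[OF tree LV])
  then have "edges T' \<inter> spanning_verts T L \<times> spanning_verts T L =
      edges T \<inter> spanning_verts T L \<times> spanning_verts T L"
    using fresh by (auto simp: edges')
  then show ?thesis by (simp add: induced_tree_def spanning_subtree_def M V)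
qed

text \<open>If \<open>L\<close> has a leaf besides \<open>a\<close>, the spanning subtree passes
  through \<open>v\<close>. It is then the old spanning subtree of the contracted set with
  \<open>a\<close> hung below \<open>v\<close>, and suppression undoes this extension.\<close>

lemma induced_tree_split:
  assumes L: "L \<subseteq> leaves T'" "a \<in> L" "b \<notin> L"
  shows "rtree_iso (induced_tree T' L) (induced_tree T (retract ` L))"
proof (cases "L = {a}")
  case True
  have "induced_tree T' {a} = \<lparr>verts = {a}, tree_root = a, edges = {}\<rparr>"
    by (rule induced_tree_singleton[OF rooted_tree']) (simp add: leaves')
  moreover have "induced_tree T {v} = \<lparr>verts = {v}, tree_root = v, edges = {}\<rparr>"
    by (rule induced_tree_singleton[OF tree leaf])
  ultimately show ?thesis using True by (auto simp: retract_def rtree_iso_def)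
next
  case False
  let ?K = "retract ` L"
  have "L - {a} \<subseteq> leaves T" using L by (auto simp: leaves')
  then have LV: "L - {a} \<subseteq> verts T" "L \<subseteq> verts T'" by (auto simp: leaves_def verts')
  obtain x where x: "x \<in> L" "x \<noteq> a" using False L(2) by blast
  have K: "?K = insert v (L - {a})"
    using L LV fresh by (force simp: retract_def)
  have KV: "?K \<subseteq> verts T" "?K \<noteq> {}" using K LV v_verts by auto
  have M: "mrca T' L = mrca T ?K" using mrca_retract[OF LV(2)] x LV by blast
  have V: "spanning_verts T' L = insert a (spanning_verts T ?K)"
  proof
    have "y \<in> spanning_verts T ?K" if y: "y \<in> spanning_verts T' L" "y \<noteq> a" for y
      unfolding spanning_verts_def
    proof safe
      fix U assume U: "connected_verts T U" "?K \<subseteq> U"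
      then have "connected_verts T' (insert a U)" "L \<subseteq> insert a U"
        using connected_verts_insert K by auto
      then show "y \<in> U" using y by (auto simp: spanning_verts_def)
    qed
    then show "spanning_verts T' L \<subseteq> insert a (spanning_verts T ?K)" by blast
    have "y \<in> U" if U: "connected_verts T' U" "L \<subseteq> U" and y: "y \<in> spanning_verts T ?K" for U y
    proof -
      have "v \<in> U" using connected_verts_parent[OF U(1)] U(2) L(2) x by blast
      then have "?K \<subseteq> U \<inter> verts T" using K KV U by auto
      then show ?thesis using y connected_verts_down[OF U(1)] by (auto simp: spanning_verts_def)
    qed
    then show "insert a (spanning_verts T ?K) \<subseteq> spanning_verts T' L"
      using L(2) by (auto simp: spanning_verts_def)
  qed
  let ?V = "spanning_verts T ?K"
  have VT: "?V \<subseteq> verts T" by (rule spanning_verts_subset[OF tree KV(1)])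
  have vV: "v \<in> ?V" using subset_spanning_verts[of ?K T] K by auto
  have root: "mrca T ?K \<noteq> a"
    using mrca_in_verts[OF tree KV] fresh by metis
  have E: "edges T' \<inter> insert a ?V \<times> insert a ?V = insert (v, a) (edges T \<inter> ?V \<times> ?V)"
    using VT vV fresh edges_subset by (auto simp: edges')
  let ?P = "spanning_subtree T ?K"
  have "spanning_subtree T' L = \<lparr>verts = insert a (verts ?P), tree_root = tree_root ?P,
      edges = insert (v, a) (edges ?P)\<rparr>"
    unfolding spanning_subtree_def V M E by simp
  moreover have "rtree_iso (suppress \<lparr>verts = insert a (verts ?P), tree_root = tree_root ?P,
      edges = insert (v, a) (edges ?P)\<rparr>) (suppress ?P)"
    by (rule suppress_extend_leaf)
      (use vV root VT fresh v_childless in \<open>auto simp: spanning_subtree_def\<close>)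
  ultimately show ?thesis by (simp add: induced_tree_def)
qed

lemma induced_tree_retract:
  assumes L: "L \<subseteq> leaves T'" "L \<noteq> {}" and ab: "\<not> (a \<in> L \<and> b \<in> L)"
  shows "rtree_iso (induced_tree T' L) (induced_tree T (retract ` L))"
proof (cases "a \<in> L \<or> b \<in> L")
  case False
  then have "retract ` L = id ` L" by (intro image_cong) (auto simp: retract_def)
  then show ?thesis using induced_tree_unsplit[OF L] False by (simp add: rtree_iso_refl)
next
  case True
  \<comment> \<open>The case \<open>b \<in> L\<close> follows by exchanging the roles of
    \<open>a\<close> and \<open>b\<close>.\<close>
  interpret s: leaf_split T v b a by (rule swap)
  have "s.retract = retract" by (auto simp: s.retract_def retract_def)
  then show ?thesis
    using True ab L(1) induced_tree_split s.induced_tree_split split_leaf_commute by metis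
qed

end

section \<open>Blowing up the leaves of a tree\<close>

text \<open>\<open>\<pi>\<close> sends a leaf of \<open>T'\<close> to the leaf of \<open>T\<close> that it arose from.\<close>

definition leaf_blowup :: "'a rtree \<Rightarrow> 'a rtree \<Rightarrow> ('a \<Rightarrow> 'a) \<Rightarrow> bool" where
  "leaf_blowup T' T \<pi> \<longleftrightarrow> \<pi> ` leaves T' \<subseteq> leaves T \<and>
     (\<forall>L \<subseteq> leaves T'. L \<noteq> {} \<longrightarrow> inj_on \<pi> L \<longrightarrow>
        rtree_iso (induced_tree T' L) (induced_tree T (\<pi> ` L)))"

lemma leaf_blowupD:
  "leaf_blowup T' T \<pi> \<Longrightarrow> L \<subseteq> leaves T' \<Longrightarrow> L \<noteq> {} \<Longrightarrow> inj_on \<pi> L \<Longrightarrow>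
     rtree_iso (induced_tree T' L) (induced_tree T (\<pi> ` L))"
  by (simp add: leaf_blowup_def)

lemma finite_leaves: "rooted_tree T \<Longrightarrow> finite (leaves T)"
  unfolding rooted_tree_def leaves_def by simp

lemma dary_tree_rooted: "dary_tree d T \<Longrightarrow> rooted_tree T"
  by (simp add: dary_tree_def topological_tree_def)

text \<open>Induction on the total weight: lower by one a weight that is at least 2, blow up
  accordingly, then split one leaf of that fibre. Vertices in \<open>nat\<close> guarantee a supply
  of fresh ones.\<close>

lemma leaf_blowup_exists:
  fixes T :: "nat rtree"
  assumes T: "dary_tree d T" and d: "d \<ge> 2" and w: "\<forall>l\<in>leaves T. w l \<ge> 1"
  shows "\<exists>T' \<pi>. dary_tree d T' \<and> leaf_blowup T' T \<pi> \<and>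
           (\<forall>l\<in>leaves T. card {x \<in> leaves T'. \<pi> x = l} = w l)"
  using w
proof (induction w rule: measure_induct_rule[of "\<lambda>w. sum w (leaves T)"])
  case (less w)
  have fin: "finite (leaves T)" by (rule finite_leaves[OF dary_tree_rooted[OF T]])
  show ?case
  proof (cases "\<forall>l\<in>leaves T. w l = 1")
    case True
    have "{x \<in> leaves T. x = l} = {l}" if "l \<in> leaves T" for l using that by auto
    then show ?thesis using True T
      by (intro exI[of _ T] exI[of _ "\<lambda>x. x"]) (simp add: leaf_blowup_def rtree_iso_refl)
  next
    case False
    then obtain l0 where l0: "l0 \<in> leaves T" "w l0 \<ge> 2"
      using less.prems by (metis One_nat_def Suc_1 le_antisym not_less_eq_eq)
    let ?w = "w(l0 := w l0 - 1)"
    have "sum ?w (leaves T) < sum w (leaves T)"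
      using fin l0 by (intro sum_strict_mono_ex1) auto
    moreover have "\<forall>l\<in>leaves T. ?w l \<ge> 1" using less.prems l0 by auto
    ultimately obtain T1 \<pi> where T1: "dary_tree d T1" "leaf_blowup T1 T \<pi>"
      "\<And>l. l \<in> leaves T \<Longrightarrow> card {x \<in> leaves T1. \<pi> x = l} = ?w l"
      using less.IH by blast
    have rT1: "rooted_tree T1" by (rule dary_tree_rooted[OF T1(1)])
    have "card {x \<in> leaves T1. \<pi> x = l0} \<noteq> 0" using T1(3)[OF l0(1)] l0(2) by simp
    then have "{x \<in> leaves T1. \<pi> x = l0} \<noteq> {}" by (metis card.empty)
    then obtain v where v: "v \<in> leaves T1" "\<pi> v = l0" by blast
    have finV: "finite (verts T1)" using rT1 by (simp add: rooted_tree_def)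
    obtain a where a: "a \<notin> verts T1" using finV ex_new_if_finite infinite_UNIV_nat by blast
    obtain b where b: "b \<notin> insert a (verts T1)"
      using finV ex_new_if_finite infinite_UNIV_nat by (metis finite_insert)
    interpret leaf_split T1 v a b
      using rT1 v(1) a b by unfold_locales auto
    have ab_leaves: "a \<notin> leaves T1" "b \<notin> leaves T1" using fresh by (auto simp: leaves_def)
    have retract_leaves: "retract x \<in> leaves T1" if "x \<in> leaves T'" for x
      using that leaf by (auto simp: leaves' retract_def)
    have retract_other: "retract x = x" if "x \<in> leaves T1" for x
      using that ab_leaves by (auto simp: retract_def)
    have "leaf_blowup T' T (\<pi> \<circ> retract)"
      unfolding leaf_blowup_def
    proof (intro conjI allI impI)
      show "(\<pi> \<circ> retract) ` leaves T' \<subseteq> leaves T"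
        using retract_leaves T1(2) unfolding leaf_blowup_def by fastforce
      fix L assume L: "L \<subseteq> leaves T'" "L \<noteq> {}" "inj_on (\<pi> \<circ> retract) L"
      \<comment> \<open>Both new leaves lie in one fibre, so a set on which the projection is
        injective contains at most one of them.\<close>
      have "retract a = retract b" by (simp add: retract_def)
      then have "\<not> (a \<in> L \<and> b \<in> L)" using inj_onD[OF L(3), of a b] fresh(3) by auto
      then have "rtree_iso (induced_tree T' L) (induced_tree T1 (retract ` L))"
        using induced_tree_retract L by blast
      moreover have "rtree_iso (induced_tree T1 (retract ` L)) (induced_tree T (\<pi> ` retract ` L))"
      proof (rule leaf_blowupD[OF T1(2)])
        show "retract ` L \<subseteq> leaves T1" using L(1) retract_leaves by blast
        show "inj_on \<pi> (retract ` L)" by (rule inj_on_imageI[OF L(3)])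
      qed (use L(2) in simp)
      ultimately show "rtree_iso (induced_tree T' L) (induced_tree T ((\<pi> \<circ> retract) ` L))"
        unfolding image_comp by (rule rtree_iso_trans)
    qed
    moreover have "card {x \<in> leaves T'. (\<pi> \<circ> retract) x = l} = w l" if l: "l \<in> leaves T" for l
    proof (cases "l = l0")
      case True
      let ?F = "{x \<in> leaves T1. \<pi> x = l}"
      have "retract a = v" "retract b = v" by (simp_all add: retract_def)
      then have "{x \<in> leaves T'. (\<pi> \<circ> retract) x = l} = insert a (insert b (?F - {v}))"
        using True v retract_other by (auto simp: leaves')
      moreover have "finite ?F" using finite_leaves[OF rT1] by simp
      \<comment> \<open>The fibre in \<open>T1\<close> has \<open>w l0 - 1\<close> elements; it
        loses \<open>v\<close> and gains \<open>a\<close> and \<open>b\<close>.\<close>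
      moreover have "card (?F - {v}) = w l0 - 2" using T1(3)[OF l] True v by simp
      ultimately show ?thesis using True l0 ab_leaves fresh by (simp add: card_insert_if)
    next
      case False
      have "retract a = v" "retract b = v" by (simp_all add: retract_def)
      then have "{x \<in> leaves T'. (\<pi> \<circ> retract) x = l} = {x \<in> leaves T1. \<pi> x = l}"
        using False v retract_other ab_leaves by (auto simp: leaves')
      then show ?thesis using T1(3)[OF l] False by simp
    qed
    ultimately show ?thesis using dary_tree'[OF T1(1) d] by blast
  qed
qed

lemma num_leaves_blowup:
  assumes "rooted_tree T" "rooted_tree T'" "leaf_blowup T' T \<pi>"
  shows "num_leaves T' = (\<Sum>l\<in>leaves T. card {x \<in> leaves T'. \<pi> x = l})"
  using sum.group[of "leaves T'" "leaves T" \<pi> "\<lambda>_. 1::nat"] assms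
  by (simp add: finite_leaves leaf_blowup_def num_leaves_def)

text \<open>Choosing one leaf from each fibre over a copy of \<open>S\<close> in \<open>T\<close>
  gives a copy in \<open>T'\<close>. A copy uses \<open>num_leaves S\<close> fibres of size at least
  \<open>m\<close>, and lifts of different copies differ because their projections do.\<close>

lemma copies_blowup:
  assumes T: "rooted_tree T" and T': "rooted_tree T'" and S: "rooted_tree S"
    and bl: "leaf_blowup T' T \<pi>" and m: "\<And>l. l \<in> leaves T \<Longrightarrow> m \<le> card {x \<in> leaves T'. \<pi> x = l}"
  shows "m ^ num_leaves S * copies S T \<le> copies S T'"
proof -
  define F where "F l = {x \<in> leaves T'. \<pi> x = l}" for l
  define C where "C = {L. L \<noteq> {} \<and> L \<subseteq> leaves T \<and> rtree_iso (induced_tree T L) S}"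
  define C' where "C' = {L. L \<noteq> {} \<and> L \<subseteq> leaves T' \<and> rtree_iso (induced_tree T' L) S}"
  define X where "X L = {K \<in> C'. \<pi> ` K = L}" for L
  have finC: "finite C" using finite_leaves[OF T] by (simp add: C_def)
  have finC': "finite C'" using finite_leaves[OF T'] by (simp add: C'_def)
  have X: "m ^ num_leaves S \<le> card (X L)" if L: "L \<in> C" for L
  proof -
    have LT: "L \<noteq> {}" "L \<subseteq> leaves T" "rtree_iso (induced_tree T L) S" using L by (auto simp: C_def)
    have finL: "finite L" using LT finite_leaves[OF T] finite_subset by blast
    have "card L = num_leaves S" by (rule rtree_iso_induced_card[OF T LT(2) S LT(3)])
    then have "m ^ num_leaves S = (\<Prod>l\<in>L. m)" by simp
    also have "\<dots> \<le> (\<Prod>l\<in>L. card (F l))" using m LT by (intro prod_mono) (auto simp: F_def)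
    also have "\<dots> = card (PiE L F)" using finL by (simp add: card_PiE)
    also have "\<dots> \<le> card (X L)"
    \<comment> \<open>A choice function is determined by its image, since \<open>\<pi>\<close> tells
      which leaf each chosen element belongs to.\<close>
    proof (rule card_inj_on_le[where f = "\<lambda>f. f ` L"])
      have sec: "\<pi> (f l) = l" "f l \<in> leaves T'" if "f \<in> PiE L F" "l \<in> L" for f l
        using that by (auto simp: F_def PiE_def Pi_def)
      show "inj_on (\<lambda>f. f ` L) (PiE L F)"
      proof (rule inj_onI)
        fix f g assume f: "f \<in> PiE L F" and g: "g \<in> PiE L F" and eq: "f ` L = g ` L"
        have "f l = g l" if l: "l \<in> L" for l
        proof -
          have "f l \<in> g ` L" using eq l by blast
          then obtain l' where "l' \<in> L" "f l = g l'" by blast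
          then show ?thesis using sec[OF f l] sec[OF g] by metis
        qed
        then show "f = g" using f g by (rule PiE_ext[rotated 2])
      qed
      show "(\<lambda>f. f ` L) ` PiE L F \<subseteq> X L"
      proof
        fix K assume "K \<in> (\<lambda>f. f ` L) ` PiE L F"
        then obtain f where f: "f \<in> PiE L F" and K: "K = f ` L" by blast
        have \<pi>K: "\<pi> ` K = L" using sec(1)[OF f] by (force simp: K)
        have inj: "inj_on \<pi> K" using sec(1)[OF f] by (auto simp: K inj_on_def)
        have KL: "K \<noteq> {}" "K \<subseteq> leaves T'" using LT(1) sec(2)[OF f] by (auto simp: K)
        then have "rtree_iso (induced_tree T' K) (induced_tree T L)"
          using leaf_blowupD[OF bl _ _ inj] \<pi>K by simp
        then have "rtree_iso (induced_tree T' K) S" using LT(3) by (rule rtree_iso_trans)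
        then show "K \<in> X L" using KL \<pi>K by (simp add: X_def C'_def)
      qed
      show "finite (X L)" using finC' by (simp add: X_def)
    qed
    finally show ?thesis .
  qed
  have "m ^ num_leaves S * card C = (\<Sum>L\<in>C. m ^ num_leaves S)" by simp
  also have "\<dots> \<le> (\<Sum>L\<in>C. card (X L))" by (rule sum_mono) (rule X)
  also have "\<dots> = card (\<Union>L\<in>C. X L)"
    using finC finC' by (intro card_UN_disjoint[symmetric]) (auto simp: X_def)
  also have "\<dots> \<le> card C'" using finC' by (intro card_mono) (auto simp: X_def)
  finally show ?thesis by (simp add: copies_def C_def C'_def)
qed

section \<open>Blow-ups with a prescribed number of leaves\<close>

lemma copies_le_binomial:
  assumes "rooted_tree T" "rooted_tree S"
  shows "copies S T \<le> num_leaves T choose num_leaves S"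
proof -
  have "copies S T \<le> card {L. L \<subseteq> leaves T \<and> card L = num_leaves S}"
    unfolding copies_def
    using rtree_iso_induced_card[OF assms(1) _ assms(2)] finite_leaves[OF assms(1)]
    by (intro card_mono) auto
  then show ?thesis using n_subsets[OF finite_leaves[OF assms(1)]] by (simp add: num_leaves_def)
qed

text \<open>Blows up the one-vertex tree, whose single leaf receives weight \<open>n\<close>. This
  makes the sets of densities nonempty, so that their maxima are attained.\<close>

lemma dary_tree_exists:
  assumes "d \<ge> 2" "n \<ge> 1"
  shows "\<exists>T :: nat rtree. dary_tree d T \<and> num_leaves T = n"
proof -
  define P :: "nat rtree" where "P = \<lparr>verts = {0}, tree_root = 0, edges = {}\<rparr>"
  have lP: "leaves P = {0}" by (simp add: P_def leaves_def outdegree_def)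
  have P: "dary_tree d P"
    using lP by (auto simp: dary_tree_def topological_tree_def rooted_tree_def P_def outdegree_def)
  obtain T \<pi> where T: "dary_tree d T" "leaf_blowup T P \<pi>"
    "\<forall>l\<in>leaves P. card {x \<in> leaves T. \<pi> x = l} = n"
    using leaf_blowup_exists[OF P assms(1), of "\<lambda>_. n"] assms(2) by auto
  then have "num_leaves T = n"
    using num_leaves_blowup[OF dary_tree_rooted[OF P] dary_tree_rooted[OF T(1)] T(2)] lP by simp
  then show ?thesis using T(1) by blast
qed

lemma dary_blowup_copies:
  fixes T :: "nat rtree"
  assumes T: "dary_tree d T" and d: "d \<ge> 2" and S: "rooted_tree S"
    and k: "1 \<le> num_leaves T" "num_leaves T \<le> n"
  shows "\<exists>T' :: nat rtree. dary_tree d T' \<and> num_leaves T' = n \<and>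
           (n div num_leaves T) ^ num_leaves S * copies S T \<le> copies S T'"
proof -
  let ?k = "num_leaves T" and ?m = "n div num_leaves T"
  have rT: "rooted_tree T" by (rule dary_tree_rooted[OF T])
  obtain l0 where l0: "l0 \<in> leaves T" using k(1) by (force simp: num_leaves_def)
  \<comment> \<open>One leaf absorbs the whole remainder, so the total is exactly \<open>n\<close>
    and every fibre still has at least \<open>?m\<close> elements.\<close>
  define w where "w l = (if l = l0 then ?m + n mod ?k else ?m)" for l
  have "?m \<ge> 1" using k by (simp add: div_greater_zero_iff Suc_leI)
  then have "\<forall>l\<in>leaves T. w l \<ge> 1" by (auto simp: w_def)
  from leaf_blowup_exists[OF T d this] obtain T' \<pi> where
    T': "dary_tree d T'" "leaf_blowup T' T \<pi>"
      "\<And>l. l \<in> leaves T \<Longrightarrow> card {x \<in> leaves T'. \<pi> x = l} = w l"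
    by blast
  have rT': "rooted_tree T'" by (rule dary_tree_rooted[OF T'(1)])
  have "num_leaves T' = (\<Sum>l\<in>leaves T. w l)"
    using num_leaves_blowup[OF rT rT' T'(2)] T'(3) by simp
  also have "\<dots> = (\<Sum>l\<in>leaves T. ?m + (if l = l0 then n mod ?k else 0))"
    by (rule sum.cong) (auto simp: w_def)
  also have "\<dots> = ?k * ?m + n mod ?k"
    using l0 finite_leaves[OF rT] by (simp add: sum.distrib num_leaves_def)
  finally have "num_leaves T' = n" by simp
  moreover have "?m ^ num_leaves S * copies S T \<le> copies S T'"
    by (rule copies_blowup[OF rT rT' S T'(2)]) (simp add: T'(3) w_def)
  ultimately show ?thesis using T'(1) by blast
qed

section \<open>Densities and their limits\<close>

lemma leaf_density_bounds:
  assumes "rooted_tree T" "rooted_tree S"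
  shows "0 \<le> leaf_density S T" "leaf_density S T \<le> 1"
  using copies_le_binomial[OF assms] by (auto simp: leaf_density_def divide_le_eq_1)

text \<open>For fixed \<open>n\<close> a density is an integer between 0 and a fixed binomial
  coefficient, divided by that coefficient; hence there are finitely many values although there are
  infinitely many trees.\<close>

lemma finite_leaf_densities:
  assumes "rooted_tree S" "\<And>T. P T \<Longrightarrow> rooted_tree T"
  shows "finite {leaf_density S T | T :: nat rtree. P T \<and> num_leaves T = n}"
proof (rule finite_subset)
  show "{leaf_density S T | T :: nat rtree. P T \<and> num_leaves T = n}
      \<subseteq> (\<lambda>c. real c / real (n choose num_leaves S)) ` {..n choose num_leaves S}"
    using copies_le_binomial[OF assms(2,1)] by (fastforce simp: leaf_density_def)
qed simp

lemma topological_tree_imp_dary: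
  assumes "topological_tree T"
  shows "\<exists>d\<ge>2. dary_tree d T"
proof -
  have "finite (verts T)" using assms by (simp add: topological_tree_def rooted_tree_def)
  then have "\<forall>v\<in>verts T. outdegree T v \<le> max 2 (Max (outdegree T ` verts T))"
    by (simp add: le_max_iff_disj)
  then show ?thesis using assms by (auto simp: dary_tree_def intro!: exI[of _ "max 2 _"])
qed

text \<open>The probability that \<open>s\<close> independent uniform elements of an \<open>n\<close>-set are distinct.\<close>

definition distinct_prob :: "nat \<Rightarrow> nat \<Rightarrow> real" where
  "distinct_prob s n = real (n choose s) * fact s / real n ^ s"

text \<open>For \<open>n > 0\<close> the quantity is a product of the \<open>s\<close> factors
  \<open>1 - i / n\<close>, each tending to 1.\<close>

lemma distinct_prob_tendsto: "distinct_prob s \<longlonglongrightarrow> 1"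
proof -
  have "(\<lambda>n. \<Prod>i = 0..<s. 1 - real i / real n) \<longlonglongrightarrow> (\<Prod>i = 0..<s. 1 - 0)"
    by (intro tendsto_prod tendsto_diff tendsto_const lim_const_over_n)
  moreover have "\<forall>\<^sub>F n in sequentially. (\<Prod>i = 0..<s. 1 - real i / real n) = distinct_prob s n"
    using eventually_gt_at_top[of 0]
  proof eventually_elim
    case (elim n)
    then have "(\<Prod>i = 0..<s. 1 - real i / real n) = (\<Prod>i = 0..<s. (real n - real i) / real n)"
      by (intro prod.cong) (simp_all add: diff_divide_distrib)
    then show ?case
      by (simp add: distinct_prob_def binomial_gbinomial gbinomial_prod_rev prod_dividef)
  qed
  ultimately show ?thesis by (simp add: tendsto_cong)
qed

lemma div_mult_over_tendsto:
  assumes "k \<ge> 1"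
  shows "(\<lambda>n. real (k * (n div k)) / real n) \<longlonglongrightarrow> 1"
proof (rule tendsto_sandwich)
  show "(\<lambda>n. 1 - real k / real n) \<longlonglongrightarrow> 1"
    using tendsto_diff[OF tendsto_const lim_const_over_n, of 1 "real k"] by simp
  show "\<forall>\<^sub>F n in sequentially. 1 - real k / real n \<le> real (k * (n div k)) / real n"
    using eventually_gt_at_top[of 0]
  proof eventually_elim
    case (elim n)
    have "n mod k < k" using assms by simp
    then have "n \<le> k * (n div k) + k" using mult_div_mod_eq[of k n] by linarith
    then have "real n - real k \<le> real (k * (n div k))" by linarith
    then have "(real n - real k) / real n \<le> real (k * (n div k)) / real n"
      by (intro divide_right_mono) simp_all
    then show ?case using elim by (simp add: diff_divide_distrib)
  qed
  show "\<forall>\<^sub>F n in sequentially. real (k * (n div k)) / real n \<le> 1"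
  proof (rule always_eventually, rule allI)
    show "real (k * (n div k)) / real n \<le> 1" for n
      using times_div_less_eq_dividend[of k n] by (auto simp: divide_le_eq_1 simp del: of_nat_mult)
  qed
qed simp

text \<open>Allows the correction factor lost in a blow-up to be inserted under a limsup at no
  cost.\<close>

lemma limsup_distinct_prob:
  "limsup (\<lambda>n. ereal (distinct_prob s n * f n)) = limsup (\<lambda>n. ereal (f n))"
proof -
  have "(\<lambda>n. ereal (distinct_prob s n)) \<longlonglongrightarrow> 1"
    using distinct_prob_tendsto[of s] by (simp add: one_ereal_def)
  from ereal_limsup_lim_mult[OF this, of "\<lambda>n. ereal (f n)"] show ?thesis by simp
qed

section \<open>Maximal densities of a fixed tree\<close>

context
  fixes S :: "'a rtree"
  assumes S: "rooted_tree S"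
begin

lemma finite_densities_dary:
  "finite {leaf_density S T | T :: nat rtree. dary_tree d T \<and> num_leaves T = n}"
  by (rule finite_leaf_densities[OF S dary_tree_rooted])

lemma finite_densities_topological:
  "finite {leaf_density S T | T :: nat rtree. topological_tree T \<and> num_leaves T = n}"
  by (rule finite_leaf_densities[OF S]) (simp add: topological_tree_def)

lemma leaf_density_le_max_dary:
  fixes T :: "nat rtree"
  assumes "dary_tree d T"
  shows "leaf_density S T \<le> max_density_dary d S (num_leaves T)"
  unfolding max_density_dary_def using assms by (intro Max_ge finite_densities_dary) blast

lemma leaf_density_le_max:
  fixes T :: "nat rtree"
  assumes "topological_tree T"
  shows "leaf_density S T \<le> max_density S (num_leaves T)"
  unfolding max_density_def using assms by (intro Max_ge finite_densities_topological) blast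

lemma max_dary_attained:
  assumes "d \<ge> 2" "n \<ge> 1"
  obtains T :: "nat rtree" where
    "dary_tree d T" "num_leaves T = n" "max_density_dary d S n = leaf_density S T"
proof -
  have "{leaf_density S T | T :: nat rtree. dary_tree d T \<and> num_leaves T = n} \<noteq> {}"
    using dary_tree_exists[OF assms] by blast
  from Max_in[OF finite_densities_dary this] show ?thesis
    using that by (auto simp: max_density_dary_def)
qed

lemma max_attained:
  assumes "n \<ge> 1"
  obtains T :: "nat rtree" where
    "topological_tree T" "num_leaves T = n" "max_density S n = leaf_density S T"
proof -
  obtain T :: "nat rtree" where "dary_tree 2 T" "num_leaves T = n"
    using dary_tree_exists[of 2 n] assms by auto
  then have "{leaf_density S T | T :: nat rtree. topological_tree T \<and> num_leaves T = n} \<noteq> {}"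
    by (auto simp: dary_tree_def)
  from Max_in[OF finite_densities_topological this] show ?thesis
    using that by (auto simp: max_density_def)
qed

lemma max_dary_bounds:
  assumes "d \<ge> 2" "n \<ge> 1"
  shows "0 \<le> max_density_dary d S n" "max_density_dary d S n \<le> 1"
  using max_dary_attained[OF assms] leaf_density_bounds[OF dary_tree_rooted S] by metis+

lemma max_dary_le_max:
  assumes "d \<ge> 2" "n \<ge> 1"
  shows "max_density_dary d S n \<le> max_density S n"
  using max_dary_attained[OF assms] leaf_density_le_max by (metis dary_tree_def)

lemma max_dary_mono:
  assumes "d \<ge> 2" "d \<le> e" "n \<ge> 1"
  shows "max_density_dary d S n \<le> max_density_dary e S n"
proof -
  obtain T :: "nat rtree" where
    T: "dary_tree d T" "num_leaves T = n" "max_density_dary d S n = leaf_density S T"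
    using max_dary_attained[OF assms(1,3)] .
  then have "dary_tree e T" using assms(2) by (auto simp: dary_tree_def)
  then show ?thesis using leaf_density_le_max_dary T by metis
qed

text \<open>For large \<open>n\<close>, the blow-up of \<open>T\<close> to \<open>n\<close> leaves
  is \<open>d\<close>-ary and has at least \<open>(n div k) ^ s\<close> times as many copies of
  \<open>S\<close> as \<open>T\<close>, where \<open>k\<close> and \<open>s\<close> are the leaf
  numbers of \<open>T\<close> and \<open>S\<close>. Dividing by \<open>n choose s\<close> and
  letting \<open>n\<close> grow gives the bound.\<close>

lemma liminf_max_dary_ge:
  fixes T :: "nat rtree"
  assumes T: "dary_tree d T" and d: "d \<ge> 2" and k: "num_leaves T \<ge> 1"
  shows "ereal (distinct_prob (num_leaves S) (num_leaves T) * leaf_density S T)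
           \<le> liminf (\<lambda>n. ereal (max_density_dary d S n))"
proof -
  define s where "s = num_leaves S"
  define k where "k = num_leaves T"
  \<comment> \<open>This is \<open>(n div k) ^ s * copies S T / (n choose s)\<close> for
    \<open>n \<ge> k\<close>, written with factors whose limits are known.\<close>
  define X where "X n = distinct_prob s k * leaf_density S T *
    (real (k * (n div k)) / real n) ^ s / distinct_prob s n" for n
  have k1: "k \<ge> 1" using assms(3) by (simp add: k_def)
  have "X \<longlonglongrightarrow> distinct_prob s k * leaf_density S T * 1 ^ s / 1"
    unfolding X_def
    by (intro tendsto_intros div_mult_over_tendsto distinct_prob_tendsto k1) simp
  then have "(\<lambda>n. ereal (X n)) \<longlonglongrightarrow> ereal (distinct_prob s k * leaf_density S T)" by simp
  then have "ereal (distinct_prob s k * leaf_density S T) = liminf (\<lambda>n. ereal (X n))"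
    by (rule lim_imp_Liminf[OF trivial_limit_sequentially, symmetric])
  also have "\<dots> \<le> liminf (\<lambda>n. ereal (max_density_dary d S n))"
  proof (rule Liminf_mono)
    show "\<forall>\<^sub>F n in sequentially. ereal (X n) \<le> ereal (max_density_dary d S n)"
      using eventually_ge_at_top[of k]
    proof eventually_elim
      case (elim n)
      then obtain T' :: "nat rtree" where T': "dary_tree d T'" "num_leaves T' = n"
        "(n div k) ^ s * copies S T \<le> copies S T'"
        using dary_blowup_copies[OF T d S] k1 unfolding k_def s_def by blast
      have "copies S T \<le> k choose s"
        unfolding k_def s_def by (rule copies_le_binomial[OF dary_tree_rooted[OF T] S])
      \<comment> \<open>If the binomial coefficient is 0, the bound just shown forces the number of
        copies to be 0 as well.\<close>
      then have dens: "real (k choose s) * leaf_density S T = real (copies S T)"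
        by (cases "k choose s = 0") (simp_all add: leaf_density_def del: binomial_eq_0_iff flip: k_def s_def)
      have n: "real n \<noteq> 0" "real k \<noteq> 0" using k1 elim by simp_all
      have "X n = real (n div k) ^ s * (real (k choose s) * leaf_density S T) / real (n choose s)"
        using n by (simp add: X_def distinct_prob_def power_mult_distrib power_divide)
      also have "\<dots> = real ((n div k) ^ s * copies S T) / real (n choose s)"
        by (simp add: dens)
      also have "\<dots> \<le> real (copies S T') / real (n choose s)"
        using T'(3) by (intro divide_right_mono) (simp_all only: of_nat_le_iff of_nat_0_le_iff)
      also have "\<dots> = leaf_density S T'" using T'(2) by (simp add: leaf_density_def s_def)
      also have "\<dots> \<le> max_density_dary d S n" using leaf_density_le_max_dary[OF T'(1)] T'(2) by simp
      finally show ?case by simp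
    qed
  qed
  finally show ?thesis by (simp add: k_def s_def)
qed

text \<open>The preceding bound, applied to an optimal \<open>d\<close>-ary tree with
  \<open>n\<close> leaves, puts each maximal density times \<open>distinct_prob\<close> below the
  liminf. Since that factor tends to 1, limsup and liminf coincide.\<close>

lemma max_dary_tendsto:
  assumes d: "d \<ge> 2"
  shows "(\<lambda>n. ereal (max_density_dary d S n)) \<longlonglongrightarrow> ereal (inducibility_dary d S)"
proof -
  let ?M = "\<lambda>n. ereal (max_density_dary d S n)"
  have "limsup ?M = limsup (\<lambda>n. ereal (distinct_prob (num_leaves S) n * max_density_dary d S n))"
    by (simp only: limsup_distinct_prob)
  also have "\<dots> \<le> liminf ?M"
  proof (rule Limsup_bounded)
    show "\<forall>\<^sub>F n in sequentially.
        ereal (distinct_prob (num_leaves S) n * max_density_dary d S n) \<le> liminf ?M"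
      using eventually_ge_at_top[of 1]
    proof eventually_elim
      case (elim n)
      then show ?case
        using max_dary_attained[OF d elim] liminf_max_dary_ge[OF _ d] by metis
    qed
  qed
  finally have eq: "liminf ?M = limsup ?M" by (simp add: Liminf_le_Limsup antisym)
  have "0 \<le> liminf ?M"
    using max_dary_bounds(1)[OF d] by (intro Liminf_bounded eventually_sequentiallyI[of 1]) auto
  moreover have "limsup ?M \<le> 1"
    using max_dary_bounds(2)[OF d]
    by (intro Limsup_bounded eventually_sequentiallyI[of 1]) (auto simp: one_ereal_def)
  \<comment> \<open>Finiteness yields a real limit, which \<open>lim\<close> in the definition of
    \<open>inducibility_dary\<close> then picks.\<close>
  ultimately have "\<bar>liminf ?M\<bar> \<noteq> \<infinity>" unfolding eq by auto
  then obtain l where l: "liminf ?M = ereal l" by (metis ereal_real')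
  then have lim: "?M \<longlonglongrightarrow> ereal l" 
    using eq by (simp only: tendsto_iff_Liminf_eq_Limsup trivial_limit_sequentially not_False_eq_True)
  then have "inducibility_dary d S = l" unfolding inducibility_dary_def by (intro limI) simp
  then show ?thesis using lim by simp
qed

section \<open>Comparing the two inducibilities\<close>

lemma inducibility_dary_mono:
  assumes "d \<ge> 2" "d \<le> e"
  shows "inducibility_dary d S \<le> inducibility_dary e S"
proof -
  have "(\<lambda>n. max_density_dary d S n) \<longlonglongrightarrow> inducibility_dary d S"
    "(\<lambda>n. max_density_dary e S n) \<longlonglongrightarrow> inducibility_dary e S"
    using max_dary_tendsto[of d] max_dary_tendsto[of e] assms by simp_all
  then show ?thesis
    by (rule LIMSEQ_le) (use max_dary_mono[OF assms] in blast)
qed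

lemma inducibility_dary_le:
  assumes "d \<ge> 2"
  shows "ereal (inducibility_dary d S) \<le> inducibility S"
proof -
  have "ereal (inducibility_dary d S) = limsup (\<lambda>n. ereal (max_density_dary d S n))"
    using lim_imp_Limsup[OF trivial_limit_sequentially max_dary_tendsto[OF assms]] by simp
  also have "\<dots> \<le> inducibility S"
    unfolding inducibility_def using max_dary_le_max[OF assms]
    by (intro Limsup_mono eventually_sequentiallyI[of 1]) auto
  finally show ?thesis .
qed

text \<open>An optimal topological tree with \<open>n\<close> leaves is \<open>d\<close>-ary for
  some \<open>d\<close> that may depend on \<open>n\<close>. Its blow-ups bound its density times
  \<open>distinct_prob\<close> by the \<open>d\<close>-ary inducibility, hence by the supremum; the
  shift by 2 keeps to degrees at least 2.\<close>

lemma inducibility_le_SUP: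
  "inducibility S \<le> (SUP d. ereal (inducibility_dary (d + 2) S))"
proof -
  have "inducibility S =
      limsup (\<lambda>n. ereal (distinct_prob (num_leaves S) n * max_density S n))"
    by (simp only: limsup_distinct_prob inducibility_def)
  also have "\<dots> \<le> (SUP d. ereal (inducibility_dary (d + 2) S))"
  proof (intro Limsup_bounded eventually_sequentiallyI[of 1])
    fix n :: nat assume n: "n \<ge> 1"
    obtain T :: "nat rtree" where
      T: "topological_tree T" "num_leaves T = n" "max_density S n = leaf_density S T"
      using max_attained[OF n] .
    obtain d where d: "d \<ge> 2" "dary_tree d T" using topological_tree_imp_dary[OF T(1)] by blast
    have "ereal (distinct_prob (num_leaves S) n * max_density S n) \<le>
        liminf (\<lambda>n. ereal (max_density_dary d S n))"
      using liminf_max_dary_ge[OF d(2,1)] T n by simp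
    also have "\<dots> = ereal (inducibility_dary (d - 2 + 2) S)"
      using lim_imp_Liminf[OF trivial_limit_sequentially max_dary_tendsto[OF d(1)]] d(1)
      by (simp only: le_add_diff_inverse2)
    also have "\<dots> \<le> (SUP d. ereal (inducibility_dary (d + 2) S))"
      by (rule SUP_upper) simp
    finally show "ereal (distinct_prob (num_leaves S) n * max_density S n) \<le>
        (SUP d. ereal (inducibility_dary (d + 2) S))" .
  qed
  finally show ?thesis .
qed

end

theorem theorem7:
  fixes S :: "'a rtree"
  assumes "topological_tree S"
  shows "(\<lambda>d. ereal (inducibility_dary d S)) \<longlonglongrightarrow> inducibility S"
proof -
  have S: "rooted_tree S" using assms by (simp add: topological_tree_def)
  \<comment> \<open>Monotonicity is available from degree 2 on; \<open>LIMSEQ_offset\<close> removes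
    the shift at the end.\<close>
  let ?I = "\<lambda>d. ereal (inducibility_dary (d + 2) S)"
  have "incseq ?I" using inducibility_dary_mono[OF S] by (auto simp: incseq_def)
  then have "?I \<longlonglongrightarrow> (SUP d. ?I d)" by (rule LIMSEQ_SUP)
  moreover have "(SUP d. ?I d) \<le> inducibility S"
    using inducibility_dary_le[OF S] by (intro SUP_least) simp
  ultimately have "?I \<longlonglongrightarrow> inducibility S"
    using inducibility_le_SUP[OF S] by (metis antisym)
  then show ?thesis by (rule LIMSEQ_offset)
qed

end
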